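(* Let $(Y,\|\cdot\|)$ be a normed space and $K\subset Y$ a closed, convex and pointed cone. Let $G,H\subseteq Y^*$ be nonempty, convex and $w^*$-compact, and let $\Psi:Y\to\mathbb{R}$, $\Psi(y):=\sigma_G(y)-\sigma_H(y)$. Then: (i) $\Psi$ is $K$-monotone if and only if $H^y\preceq_s^{K^*}G^y$ for all $y\in Y$. (ii) If $\operatorname{int}(K)\neq\emptyset$ and $H^y\preceq_u^{K^*\setminus\{0\}}G^y$ for all $y\in Y$, then $\Psi$ is strictly $K$-monotone. (iii) If $K^{s*}\neq\emptyset$ and $H^y\preceq_u^{K^{s*}}G^y$ for all $y\in Y$, then $\Psi$ is strongly $K$-monotone.
   Context: Spaces are real; $Y^*$ is the topological dual. A cone is a set $C$ with $tx\in C$ for all $x\in C$, $t\ge 0$. $K^*=\{y^*\in Y^*:\langle y^*,y\rangle\ge 0\ \forall y\in K\}$ and $K^{s*}=\{y^*\in Y^*:\langle y^*,y\rangle>0\ \forall y\in K\setminus\{0\}\}$. For $A\subseteq Y^*$, $\sigma_A(y):=\sup_{y^*\in A}\langle y^*,y\rangle$, and $A^y:=\{y^*\in A:\langle y^*,y\rangle=\sigma_A(y)\}$ for $y\in Y$. For $D,A,B\subseteq Y^*$: $A\preceq_l^{D}B$ iff $B\subseteq A+D$; $A\preceq_u^{D}B$ iff $A\subseteq B-D$; $A\preceq_s^{D}B$ iff both $A\preceq_l^DB$ and $A\preceq_u^DB$. $\Psi$ is $K$-monotone if $z-y\in K\Rightarrow\Psi(y)\le\Psi(z)$; strictly $K$-monotone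 if $z-y\in\operatorname{int}(K)\Rightarrow\Psi(y)<\Psi(z)$; strongly $K$-monotone if $z-y\in K,\ y\ne z\Rightarrow\Psi(y)<\Psi(z)$. *)

theory Defs
  imports "HOL-Analysis.Analysis"
begin

text \<open>The topological dual of a real normed space \<open>'a\<close> is the type \<open>'a \<Rightarrow>\<^sub>L real\<close>.\<close>

type_synonym 'a dual = "'a \<Rightarrow>\<^sub>L real"

text \<open>For scalar-valued operators the topology of pointwise convergence, which the library
  calls the strong operator topology, is the weak* topology.\<close>

abbreviation weak_star_topology :: "'a::real_normed_vector dual topology" where
  "weak_star_topology \<equiv> strong_operator_topology"

text \<open>Since \<open>cone {}\<close> holds in the library, note that this also forces \<open>K \<noteq> {}\<close>.\<close>

definition pointed :: "'a::real_vector set \<Rightarrow> bool" where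
  "pointed K \<longleftrightarrow> K \<inter> uminus ` K = {0}"

definition dual_cone :: "'a::real_normed_vector set \<Rightarrow> 'a dual set" where
  "dual_cone K = {f. \<forall>y\<in>K. blinfun_apply f y \<ge> 0}"

definition strict_dual_cone :: "'a::real_normed_vector set \<Rightarrow> 'a dual set" where
  "strict_dual_cone K = {f. \<forall>y\<in>K - {0}. blinfun_apply f y > 0}"

text \<open>The supremum is taken in \<open>real\<close>, so this is the support functional only where \<open>A\<close> is nonempty
  and pointwise bounded above; every nonempty weak*-compact \<open>A\<close> is.\<close>

definition support_fun :: "'a::real_normed_vector dual set \<Rightarrow> 'a \<Rightarrow> real" where
  "support_fun A y = (SUP f\<in>A. blinfun_apply f y)"

definition support_face :: "'a::real_normed_vector dual set \<Rightarrow> 'a \<Rightarrow> 'a dual set" where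
  "support_face A y = {f \<in> A. blinfun_apply f y = support_fun A y}"

text \<open>The sets \<open>A + D\<close> and \<open>B - D\<close> in the following relations are Minkowski sums and differences;
  they are written out because \<open>-\<close> on sets is the set difference in HOL.\<close>

definition set_le_l :: "'b::ab_group_add set \<Rightarrow> 'b set \<Rightarrow> 'b set \<Rightarrow> bool" where
  "set_le_l D A B \<longleftrightarrow> B \<subseteq> {a + d | a d. a \<in> A \<and> d \<in> D}"

definition set_le_u :: "'b::ab_group_add set \<Rightarrow> 'b set \<Rightarrow> 'b set \<Rightarrow> bool" where
  "set_le_u D A B \<longleftrightarrow> A \<subseteq> {b - d | b d. b \<in> B \<and> d \<in> D}"

definition set_le_s :: "'b::ab_group_add set \<Rightarrow> 'b set \<Rightarrow> 'b set \<Rightarrow> bool" where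
  "set_le_s D A B \<longleftrightarrow> set_le_l D A B \<and> set_le_u D A B"

definition cone_monotone :: "'a::real_normed_vector set \<Rightarrow> ('a \<Rightarrow> real) \<Rightarrow> bool" where
  "cone_monotone K \<Psi> \<longleftrightarrow> (\<forall>y z. z - y \<in> K \<longrightarrow> \<Psi> y \<le> \<Psi> z)"

definition strictly_cone_monotone :: "'a::real_normed_vector set \<Rightarrow> ('a \<Rightarrow> real) \<Rightarrow> bool" where
  "strictly_cone_monotone K \<Psi> \<longleftrightarrow> (\<forall>y z. z - y \<in> interior K \<longrightarrow> \<Psi> y < \<Psi> z)"

definition strongly_cone_monotone :: "'a::real_normed_vector set \<Rightarrow> ('a \<Rightarrow> real) \<Rightarrow> bool" where
  "strongly_cone_monotone K \<Psi> \<longleftrightarrow> (\<forall>y z. z - y \<in> K \<and> y \<noteq> z \<longrightarrow> \<Psi> y < \<Psi> z)"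

end

theory Submission
  imports Defs
begin

text \<open>
  For (i), let \<open>h\<close> lie in \<open>H\<^sup>y\<close>. A \<open>g\<close> in \<open>G\<^sup>y\<close> with \<open>g - h\<close> in \<open>K\<^sup>*\<close> is a
  functional in \<open>G\<close> that dominates \<open>h\<close> on \<open>K\<close> and has \<open>g y \<ge> \<sigma>\<^sub>G y\<close>: a system of linear
  inequalities over the weak* compact convex set \<open>G\<close>. By compactness and separation in the
  plane it is solvable as soon as each inequality from the convex cone it generates is solvable
  on its own, and a single inequality reads \<open>\<sigma>\<^sub>G (\<mu> y + k) \<ge> \<mu> \<sigma>\<^sub>G y + h k\<close>, which is
  monotonicity of \<open>\<Psi>\<close> at \<open>\<mu> y\<close>. The other inclusion is the same statement for the pair
  \<open>(H, G)\<close> and the cone \<open>-K\<close>.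

  Conversely, elements of \<open>G\<^sup>x\<close> and \<open>H\<^sup>x\<close> are subgradients of \<open>\<sigma>\<^sub>G\<close> and
  \<open>\<sigma>\<^sub>H\<close> at \<open>x\<close>. If \<open>h\<^sub>x \<in> H\<^sup>x\<close> is dominated at \<open>k\<close> by some element of \<open>G\<^sup>x\<close>,
  then \<open>\<Psi> (x + \<delta> k) - \<Psi> x \<ge> \<delta> (h\<^sub>x k - h\<^bsub>x + \<delta> k\<^esub> k)\<close>. Over a partition of the segment from \<open>y\<close> to
  \<open>y + k\<close> these bounds telescope to something that vanishes with the mesh. If the domination
  is strict but \<open>\<Psi>\<close> is constant on the segment, the intervals between the slopes are disjoint
  for different points of the segment, and there are uncountably many of them.
\<close>

section \<open>Linear inequalities over weak* compact convex sets\<close>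

text \<open>If \<open>S\<close> missed the quadrant above \<open>(r, s)\<close>, a line would
  separate them strictly. The quadrant is unbounded to the right and upwards, so the normal has
  nonnegative entries, which contradicts \<open>ex\<close>.\<close>

lemma compact_convex_two_constraints:
  fixes S :: "(real \<times> real) set"
  assumes "compact S" "convex S"
    and ex: "\<And>a b. 0 \<le> a \<Longrightarrow> 0 \<le> b \<Longrightarrow> \<exists>(u, v)\<in>S. a * r + b * s \<le> a * u + b * v"
  shows "\<exists>(u, v)\<in>S. r \<le> u \<and> s \<le> v"
proof (rule ccontr)
  let ?T = "{r..} \<times> {s..}"
  assume "\<not> ?thesis"
  then have "S \<inter> ?T = {}" by auto
  moreover have "S \<noteq> {}" using ex[of 0 0] by auto
  moreover have "convex ?T" "closed ?T" by (auto intro: convex_Times closed_Times)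
  ultimately obtain p c where S: "\<And>x. x \<in> S \<Longrightarrow> inner p x < c"
    and T: "\<And>x. x \<in> ?T \<Longrightarrow> inner p x > c"
    using separating_hyperplane_compact_closed[OF \<open>convex S\<close> \<open>compact S\<close>] by metis
  obtain a b where p: "p = (a, b)" by fastforce
  have T': "a * u + b * v > c" if "r \<le> u" "s \<le> v" for u v
    using T[of "(u, v)"] that by (simp add: p)
  \<comment> \<open>Were \<open>a\<close> negative, moving right from the corner
    \<open>(r, s)\<close> would lower the functional to exactly \<open>c\<close> while staying in
    the quadrant.\<close>
  have "0 \<le> a"
  proof (rule ccontr)
    assume "\<not> 0 \<le> a"
    moreover from this have "a * (r + (a * r + b * s - c) / (- a)) + b * s = c"
      by (simp add: field_simps)
    ultimately show False
      using T'[of "r + (a * r + b * s - c) / (- a)" s] T'[of r s]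
      by (smt (verit) divide_nonneg_nonneg)
  qed
  moreover have "0 \<le> b"
  proof (rule ccontr)
    assume "\<not> 0 \<le> b"
    moreover from this have "a * r + b * (s + (a * r + b * s - c) / (- b)) = c"
      by (simp add: field_simps)
    ultimately show False
      using T'[of r "s + (a * r + b * s - c) / (- b)"] T'[of r s]
      by (smt (verit) divide_nonneg_nonneg)
  qed
  ultimately obtain u v where "(u, v) \<in> S" "a * r + b * s \<le> a * u + b * v"
    using ex by blast
  then show False using S[of "(u, v)"] T'[of r s] by (simp add: p)
qed

lemma closedin_weak_star_halfspace:
  "closedin weak_star_topology {g :: 'a::real_normed_vector dual. r \<le> g x}"
proof -
  have "closedin weak_star_topology {g \<in> topspace weak_star_topology. blinfun_apply g x \<in> {r..}}"
    by (rule closedin_continuous_map_preimage[OF strong_operator_topology_continuous_evaluation])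
       simp
  then show ?thesis by (simp add: strong_operator_topology_topspace)
qed

lemma convex_blinfun_halfspace: "convex {g :: 'a::real_normed_vector dual. r \<le> g x}"
proof -
  have "linear (\<lambda>g :: 'a dual. g x)"
    by (rule linearI) (auto simp: blinfun.add_left blinfun.scaleR_left)
  then have "convex ((\<lambda>g :: 'a dual. g x) -` {r..})"
    by (rule convex_linear_vimage) simp
  then show ?thesis by (simp add: vimage_def)
qed

text \<open>Evaluation at \<open>x\<close> and \<open>y\<close> maps \<open>C\<close> linearly and
  weak* continuously onto a compact convex set in the plane.\<close>

lemma weak_star_compact_two_constraints:
  fixes C :: "'a::real_normed_vector dual set"
  assumes C: "compactin weak_star_topology C" "convex C"
    and ex: "\<And>a b. 0 \<le> a \<Longrightarrow> 0 \<le> b \<Longrightarrow> \<exists>g\<in>C. a * r + b * s \<le> g (a *\<^sub>R x + b *\<^sub>R y)"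
  shows "\<exists>g\<in>C. r \<le> g x \<and> s \<le> g y"
proof -
  let ?f = "\<lambda>g :: 'a dual. (g x, g y)"
  have "continuous_map weak_star_topology (prod_topology euclidean euclidean) ?f"
    by (intro continuous_map_pairedI strong_operator_topology_continuous_evaluation)
  then have "compact (?f ` C)"
    using image_compactin[OF C(1)] by fastforce
  moreover have "linear ?f"
    by (rule linearI) (auto simp: blinfun.add_left blinfun.scaleR_left)
  then have "convex (?f ` C)"
    by (rule convex_linear_image) fact
  moreover have "\<exists>(u, v)\<in>?f ` C. a * r + b * s \<le> a * u + b * v" if "0 \<le> a" "0 \<le> b" for a b
    using ex[OF that] by (auto simp: blinfun.add_right blinfun.scaleR_right)
  ultimately have "\<exists>(u, v)\<in>?f ` C. r \<le> u \<and> s \<le> v"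
    by (rule compact_convex_two_constraints)
  then show ?thesis by auto
qed

text \<open>Compactness reduces the system to finite subsystems, built up one constraint at a time.
  As \<open>P\<close> is a convex cone, a nonnegative combination of two constraints is again a
  single constraint from \<open>P\<close>.\<close>

lemma weak_star_compact_linear_system:
  fixes C :: "'a::real_normed_vector dual set" and P :: "('a \<times> real) set"
  assumes C: "compactin weak_star_topology C" "convex C"
    and P: "convex P" "cone P"
    and ex: "\<And>x r. (x, r) \<in> P \<Longrightarrow> \<exists>g\<in>C. r \<le> g x"
    and "C \<noteq> {}"
  shows "\<exists>g\<in>C. \<forall>(x, r)\<in>P. r \<le> g x"
proof -
  define S where "S = (\<lambda>(x, r). {g :: 'a dual. r \<le> g x})"
  have S: "g \<in> S (x, r) \<longleftrightarrow> r \<le> g x" for g x r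
    by (simp add: S_def)
  have closed: "closedin weak_star_topology (S p)" for p
    by (cases p) (simp add: S_def closedin_weak_star_halfspace)
  \<comment> \<open>Each constraint may be added to \<open>C\<close> without affecting solvability of the single ones.\<close>
  have fin: "compactin weak_star_topology (C \<inter> \<Inter>(S ` F)) \<and> convex (C \<inter> \<Inter>(S ` F)) \<and>
      (\<forall>p\<in>P. C \<inter> \<Inter>(S ` F) \<inter> S p \<noteq> {})"
    if "finite F" "F \<subseteq> P" for F
    using that
  proof (induction F rule: finite_induct)
    case empty
    have "C \<inter> S p \<noteq> {}" if "p \<in> P" for p
      using ex[of "fst p" "snd p"] that S[of _ "fst p" "snd p"] by auto
    then show ?case using C by simp
  next
    case (insert q F)
    let ?D = "C \<inter> \<Inter>(S ` F)"
    obtain y s where q: "q = (y, s)" by fastforce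
    have eq: "C \<inter> \<Inter>(S ` insert q F) = ?D \<inter> S q" by auto
    have IH: "compactin weak_star_topology ?D \<and> convex ?D \<and> (\<forall>p\<in>P. ?D \<inter> S p \<noteq> {})"
      using insert.prems by (intro insert.IH) simp
    note D = conjunct1[OF IH] conjunct1[OF conjunct2[OF IH]]
    have ne: "?D \<inter> S p \<noteq> {}" if "p \<in> P" for p
      using IH that by (elim conjE) (rule bspec)
    have "?D \<inter> S q \<inter> S p \<noteq> {}" if p: "p \<in> P" for p
    proof -
      obtain x r where pe: "p = (x, r)" by fastforce
      have "\<exists>g\<in>?D. r \<le> g x \<and> s \<le> g y"
      proof (rule weak_star_compact_two_constraints[OF D])
        fix a b :: real
        assume "0 \<le> a" "0 \<le> b"
        then have "a *\<^sub>R p + b *\<^sub>R q \<in> P"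
          using P p insert.prems convex_cone[of P] by blast
        then have "(a *\<^sub>R x + b *\<^sub>R y, a * r + b * s) \<in> P"
          by (simp add: pe q)
        from ne[OF this] show "\<exists>g\<in>?D. a * r + b * s \<le> g (a *\<^sub>R x + b *\<^sub>R y)"
          unfolding S[symmetric] by blast
      qed
      then show ?thesis unfolding S[symmetric] pe q by blast
    qed
    moreover have "convex (?D \<inter> S q)"
      by (rule convex_Int[OF D(2)]) (simp add: S_def q convex_blinfun_halfspace)
    moreover have "compactin weak_star_topology (?D \<inter> S q)"
      using D(1) closed by (rule compact_Int_closedin)
    ultimately show ?case unfolding eq by (intro conjI ballI)
  qed
  have "C \<inter> \<Inter>(S ` P) \<noteq> {}"
  \<comment> \<open>\<open>fin\<close> gives nonemptiness only together with one further constraint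
    from \<open>P\<close>, so a member of \<open>P\<close> is needed.\<close>
  proof (cases "P = {}")
    case False
    then obtain p where "p \<in> P" by blast
    have "C \<inter> \<Inter>\<F> \<noteq> {}" if \<F>: "finite \<F>" "\<F> \<subseteq> S ` P" for \<F>
    proof -
      obtain F where F: "F \<subseteq> P" "finite F" "\<F> = S ` F"
        using finite_subset_image[OF \<F>] by metis
      have "C \<inter> \<Inter>(S ` F) \<inter> S p \<noteq> {}"
        using fin[OF F(2,1)] \<open>p \<in> P\<close> by (elim conjE) (rule bspec)
      then show ?thesis unfolding F(3) by (metis inf_bot_left)
    qed
    moreover have "\<forall>T\<in>S ` P. closedin weak_star_topology T"
      using closed by (intro ballI) (elim imageE, simp)
    ultimately show ?thesis
      by (intro compactin_fip[THEN iffD1, OF C(1), THEN conjunct2, THEN spec, THEN mp])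
         (intro conjI allI impI, assumption, elim conjE)
  qed (use \<open>C \<noteq> {}\<close> in simp)
  then obtain g where "g \<in> C" and g: "\<And>p. p \<in> P \<Longrightarrow> g \<in> S p"
    by blast
  have "r \<le> g x" if "(x, r) \<in> P" for x r
    using g[OF that] by (simp only: S)
  then show ?thesis using \<open>g \<in> C\<close> by blast
qed

section \<open>Support functionals, and domination between their faces\<close>

lemma compact_evaluation_image:
  fixes A :: "'a::real_normed_vector dual set"
  assumes "compactin weak_star_topology A"
  shows "compact ((\<lambda>f. blinfun_apply f y) ` A)"
  using image_compactin[OF assms strong_operator_topology_continuous_evaluation[of y]] by simp

lemma blinfun_le_support_fun:
  assumes "compactin weak_star_topology A" "f \<in> A"
  shows "blinfun_apply f y \<le> support_fun A y"
  unfolding support_fun_def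
  using compact_imp_bounded[OF compact_evaluation_image[OF assms(1)], of y] assms(2)
  by (intro cSUP_upper bounded_imp_bdd_above)

lemma support_face_nonempty:
  fixes A :: "'a::real_normed_vector dual set"
  assumes "compactin weak_star_topology A" "A \<noteq> {}"
  shows "support_face A y \<noteq> {}"
proof -
  obtain f where f: "f \<in> A" "\<And>g. g \<in> A \<Longrightarrow> blinfun_apply g y \<le> f y"
    using compact_attains_sup[OF compact_evaluation_image[OF assms(1)], of y] assms(2) by auto
  have "support_fun A y = f y"
    unfolding support_fun_def using f by (intro cSup_eq_maximum) auto
  then show ?thesis using f(1) by (auto simp: support_face_def)
qed

lemma support_fun_scaleR:
  assumes A: "compactin weak_star_topology A" "A \<noteq> {}" and "0 \<le> c"
  shows "support_fun A (c *\<^sub>R y) = c * support_fun A y"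
proof (rule antisym)
  obtain f where "f \<in> support_face A (c *\<^sub>R y)"
    using support_face_nonempty[OF A] by blast
  then show "support_fun A (c *\<^sub>R y) \<le> c * support_fun A y"
    using mult_left_mono[OF blinfun_le_support_fun[OF A(1)] \<open>0 \<le> c\<close>, of f y]
    by (simp add: support_face_def blinfun.scaleR_right)
  obtain g where "g \<in> support_face A y"
    using support_face_nonempty[OF A] by blast
  then show "c * support_fun A y \<le> support_fun A (c *\<^sub>R y)"
    using blinfun_le_support_fun[OF A(1), of g "c *\<^sub>R y"]
    by (simp add: support_face_def blinfun.scaleR_right)
qed

lemma support_fun_subgradient:
  assumes "compactin weak_star_topology A" "g \<in> support_face A x"
  shows "support_fun A x + blinfun_apply g v \<le> support_fun A (x + v)"
  using blinfun_le_support_fun[OF assms(1), of g "x + v"] assms(2)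
  by (simp add: support_face_def blinfun.add_right)

lemma support_face_dominated:
  fixes A B :: "'a::real_normed_vector dual set"
  assumes A: "compactin weak_star_topology A" "A \<noteq> {}" "convex A"
    and B: "compactin weak_star_topology B" "B \<noteq> {}"
    and C: "convex C" "cone C" "0 \<in> C"
    and mono: "\<And>y k. k \<in> C \<Longrightarrow>
      support_fun A y - support_fun B y \<le> support_fun A (y + k) - support_fun B (y + k)"
    and h: "h \<in> support_face B y"
  shows "\<exists>g\<in>support_face A y. \<forall>k\<in>C. blinfun_apply h k \<le> g k"
proof -
  \<comment> \<open>The case \<open>m = 0\<close> encodes domination of \<open>h\<close> on
    \<open>C\<close>; the case \<open>m = 1\<close>, \<open>k = 0\<close> forces the solution into
    the face at \<open>y\<close>.\<close>
  define P where "P = {(m *\<^sub>R y + k, m * support_fun A y + h k) | m k. 0 \<le> m \<and> k \<in> C}"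
  have PI: "(m *\<^sub>R y + k, m * support_fun A y + h k) \<in> P" if "0 \<le> m" "k \<in> C" for m k
    using that by (auto simp: P_def)
  have C': "k + l \<in> C" "c *\<^sub>R k \<in> C" if "k \<in> C" "l \<in> C" "0 \<le> c" for k l and c :: real
    using C(1,2) convex_cone[of C] that by blast+
  have "p + q \<in> P" if pq: "p \<in> P" "q \<in> P" for p q
  proof -
    obtain m k n l where "0 \<le> m" "k \<in> C" "0 \<le> n" "l \<in> C"
      and "p = (m *\<^sub>R y + k, m * support_fun A y + h k)"
      and "q = (n *\<^sub>R y + l, n * support_fun A y + h l)"
      using pq by (auto simp: P_def)
    then show ?thesis
      using PI[of "m + n" "k + l"] C'(1)[of k l 0] by (simp add: algebra_simps blinfun.add_right)
  qed
  moreover have "c *\<^sub>R p \<in> P" if p: "p \<in> P" "0 \<le> c" for p c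
  proof -
    obtain m k where "0 \<le> m" "k \<in> C" "p = (m *\<^sub>R y + k, m * support_fun A y + h k)"
      using p by (auto simp: P_def)
    then show ?thesis
      using PI[of "c * m" "c *\<^sub>R k"] C'(2)[of k k c] p(2)
      by (simp add: algebra_simps blinfun.scaleR_right)
  qed
  ultimately have P: "convex P" "cone P"
    using convex_cone[of P] by blast+
  have "\<exists>g\<in>A. r \<le> g x" if xr: "(x, r) \<in> P" for x r
  proof -
    obtain m k where mk: "0 \<le> m" "k \<in> C"
      and x: "x = m *\<^sub>R y + k" and r: "r = m * support_fun A y + h k"
      using xr by (auto simp: P_def)
    \<comment> \<open>As \<open>h\<close> attains the support value of \<open>B\<close> at
      \<open>y\<close>, it bounds that of \<open>B\<close> at \<open>x\<close> from below; adding
      monotonicity at \<open>m *\<^sub>R y\<close> gives the required bound for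
      \<open>A\<close>.\<close>
    have "h \<in> B" "h y = support_fun B y" using h by (auto simp: support_face_def)
    then have "m * support_fun B y + h k \<le> support_fun B x"
      using blinfun_le_support_fun[OF B(1), of h x]
      by (simp add: x blinfun.add_right blinfun.scaleR_right)
    then have "r \<le> support_fun A x"
      using mono[OF mk(2), of "m *\<^sub>R y"]
      by (simp add: x r support_fun_scaleR[OF A(1,2) mk(1)] support_fun_scaleR[OF B mk(1)])
    then show ?thesis
      using support_face_nonempty[OF A(1,2), of x] by (force simp: support_face_def)
  qed
  then obtain g where "g \<in> A" and g: "\<And>x r. (x, r) \<in> P \<Longrightarrow> r \<le> g x"
    using weak_star_compact_linear_system[OF A(1,3) P _ A(2)] by blast
  have "h k \<le> g k" if "k \<in> C" for k
    using g[OF PI[of 0 k]] that by simp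
  moreover have "support_fun A y \<le> g y"
    using g[OF PI[of 1 0]] C(3) by simp
  then have "g \<in> support_face A y"
    using blinfun_le_support_fun[OF A(1) \<open>g \<in> A\<close>, of y] \<open>g \<in> A\<close> by (simp add: support_face_def)
  ultimately show ?thesis by blast
qed

section \<open>Monotonicity along a direction from domination\<close>

lemma support_fun_diff_mono:
  fixes G H :: "'a::real_normed_vector dual set"
  assumes G: "compactin weak_star_topology G" and H: "compactin weak_star_topology H" "H \<noteq> {}"
    and dom: "\<And>x h. h \<in> support_face H x \<Longrightarrow> \<exists>g\<in>support_face G x. blinfun_apply h k \<le> g k"
  shows "support_fun G y - support_fun H y \<le> support_fun G (y + k) - support_fun H (y + k)"
proof -
  define \<Psi> where "\<Psi> x = support_fun G x - support_fun H x" for x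
  \<comment> \<open>One subgradient is fixed per point, so that neighbouring intervals share the
    slope at their common endpoint and the sum telescopes.\<close>
  obtain h where h: "h x \<in> support_face H x" for x
    using that[of "\<lambda>x. SOME h. h \<in> support_face H x"] support_face_nonempty[OF H]
    by (simp add: some_in_eq)
  define s where "s x = blinfun_apply (h x) k" for x
  \<comment> \<open>The subgradient of \<open>G\<close> is used forwards from \<open>x\<close>, that
    of \<open>H\<close> backwards from the other endpoint.\<close>
  have step: "d * (s x - s (x + d *\<^sub>R k)) \<le> \<Psi> (x + d *\<^sub>R k) - \<Psi> x" if d: "0 \<le> d" for x d
  proof -
    obtain g where g: "g \<in> support_face G x" "s x \<le> g k" using dom[OF h] s_def by auto
    show ?thesis
      using support_fun_subgradient[OF G g(1), of "d *\<^sub>R k"] mult_left_mono[OF g(2) d]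
        support_fun_subgradient[OF H(1) h, of "x + d *\<^sub>R k" "- (d *\<^sub>R k)"]
      by (simp add: \<Psi>_def s_def blinfun.scaleR_right blinfun.minus_right algebra_simps)
  qed
  have bound: "s y - s (y + k) \<le> real n * (\<Psi> (y + k) - \<Psi> y)" if "0 < n" for n
  proof -
    define x where "x i = y + (real i / real n) *\<^sub>R k" for i
    have "x (Suc i) = x i + (1 / real n) *\<^sub>R k" for i
      by (simp add: x_def add_divide_distrib scaleR_add_left)
    then have "s (x i) - s (x (Suc i)) \<le> real n * (\<Psi> (x (Suc i)) - \<Psi> (x i))" for i
      using step[of "1 / real n" "x i"] that by (simp add: field_simps)
    then have "(\<Sum>i<n. s (x i) - s (x (Suc i))) \<le> (\<Sum>i<n. real n * (\<Psi> (x (Suc i)) - \<Psi> (x i)))"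
      by (intro sum_mono)
    then have "s (x 0) - s (x n) \<le> real n * (\<Psi> (x n) - \<Psi> (x 0))"
      by (simp add: sum_lessThan_telescope[of "\<lambda>i. \<Psi> (x i)"]
          sum_lessThan_telescope'[of "\<lambda>i. s (x i)"] flip: sum_distrib_left)
    then show ?thesis using that by (simp add: x_def)
  qed
  have "\<Psi> y \<le> \<Psi> (y + k)"
  proof (rule ccontr)
    assume neg: "\<not> ?thesis"
    then obtain n where "s (y + k) - s y < real n * (\<Psi> y - \<Psi> (y + k))"
      using reals_Archimedean3[of "\<Psi> y - \<Psi> (y + k)"] by auto
    \<comment> \<open>\<open>bound\<close> needs a positive index; passing from \<open>n\<close> to
      \<open>Suc n\<close> preserves the contradiction because \<Psi> drops from \<open>y\<close> to
      \<open>y + k\<close>.\<close>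
    then show False
      using bound[of "Suc n"] neg by (simp add: algebra_simps)
  qed
  then show ?thesis by (simp add: \<Psi>_def)
qed

lemma support_fun_diff_strict_mono:
  fixes G H :: "'a::real_normed_vector dual set"
  assumes G: "compactin weak_star_topology G" and H: "compactin weak_star_topology H" "H \<noteq> {}"
    and dom: "\<And>x h. h \<in> support_face H x \<Longrightarrow> \<exists>g\<in>support_face G x. blinfun_apply h k < g k"
  shows "support_fun G y - support_fun H y < support_fun G (y + k) - support_fun H (y + k)"
proof (rule ccontr)
  define \<Psi> where "\<Psi> t = support_fun G (y + t *\<^sub>R k) - support_fun H (y + t *\<^sub>R k)" for t
  assume neg: "\<not> ?thesis"
  have mono: "\<Psi> t \<le> \<Psi> t'" if "t \<le> t'" for t t'
  proof -
    have "support_fun G x - support_fun H x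
        \<le> support_fun G (x + (t' - t) *\<^sub>R k) - support_fun H (x + (t' - t) *\<^sub>R k)" for x
    proof (rule support_fun_diff_mono[OF G H])
      fix z h
      assume "h \<in> support_face H z"
      then obtain g where "g \<in> support_face G z" "h k < g k" using dom by blast
      then show "\<exists>g\<in>support_face G z. h ((t' - t) *\<^sub>R k) \<le> g ((t' - t) *\<^sub>R k)"
        using that by (intro bexI[of _ g]) (auto simp: blinfun.scaleR_right intro!: mult_left_mono)
    qed
    from this[of "y + t *\<^sub>R k"] show ?thesis
      by (simp add: \<Psi>_def algebra_simps)
  qed
  \<comment> \<open>Without a strict increase between the endpoints, monotonicity squeezes \<Psi> to
    a constant on the unit interval.\<close>
  have const: "\<Psi> t = \<Psi> 0" if "t \<in> {0..1}" for t
    using mono[of 0 t] mono[of t 1] that neg by (simp add: \<Psi>_def)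
  \<comment> \<open>A rational between the two slopes labels each point of the segment.\<close>
  have "\<exists>h g q. h \<in> support_face H (y + t *\<^sub>R k) \<and> g \<in> support_face G (y + t *\<^sub>R k) \<and>
      blinfun_apply h k < of_rat q \<and> of_rat q < blinfun_apply g k" for t
    using support_face_nonempty[OF H] dom of_rat_dense by (metis ex_in_conv)
  then obtain h g q where h: "h t \<in> support_face H (y + t *\<^sub>R k)"
    and g: "g t \<in> support_face G (y + t *\<^sub>R k)"
    and q: "blinfun_apply (h t) k < of_rat (q t)" "of_rat (q t) < blinfun_apply (g t) k" for t
    by metis
  have "q t < q t'" if t: "t \<in> {0..1}" "t' \<in> {0..1}" "t < t'" for t t' :: real
  proof -
    \<comment> \<open>By constancy both support functionals grow equally from \<open>t\<close> to
      \<open>t'\<close>; \<open>g t\<close> bounds this growth from below and \<open>h t'\<close>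
      from above.\<close>
    have "(t' - t) * g t k \<le> (t' - t) * h t' k"
      using support_fun_subgradient[OF G g, of t "(t' - t) *\<^sub>R k"]
        support_fun_subgradient[OF H(1) h, of t' "(t - t') *\<^sub>R k"] const[OF t(1)] const[OF t(2)]
      by (simp add: \<Psi>_def blinfun.diff_right blinfun.scaleR_right algebra_simps)
    then have "g t k \<le> h t' k" using t by simp
    then have "(of_rat (q t) :: real) < of_rat (q t')" using q(2)[of t] q(1)[of t'] by simp
    then show ?thesis by (simp add: of_rat_less)
  qed
  then have "inj_on q {0..1}" by (intro linorder_inj_onI') (use less_imp_neq in blast)
  then have "countable {0..1::real}" by (rule countable_image_inj_on[rotated]) simp
  then show False using uncountable_closed_interval[of 0 "1::real"] by simp
qed

section \<open>Dual cones and the three assertions\<close>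

text \<open>From an interior point one can step a little against a direction \<open>v\<close> with
  \<open>d v > 0\<close> and stay in \<open>K\<close>, where \<open>d\<close> is still
  nonnegative.\<close>

lemma dual_cone_pos_on_interior:
  assumes d: "d \<in> dual_cone K" "d \<noteq> 0" and k: "k \<in> interior K"
  shows "0 < blinfun_apply d k"
proof -
  obtain v where v: "0 < d v"
  proof -
    obtain u where "d u \<noteq> 0" using d(2) blinfun_eqI[of d 0] by auto
    then show thesis using that[of u] that[of "- u"] by (cases "0 < d u") (auto simp: blinfun.minus_right)
  qed
  have "((\<lambda>t. k - t *\<^sub>R v) \<longlongrightarrow> k - 0 *\<^sub>R v) (at_right 0)"
    by (intro tendsto_intros)
  then have "\<forall>\<^sub>F t in at_right 0. k - t *\<^sub>R v \<in> interior K"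
    using k by (intro topological_tendstoD) auto
  then have "\<forall>\<^sub>F t in at_right 0. 0 < t \<and> k - t *\<^sub>R v \<in> K"
    using eventually_at_right_less[of "0::real"]
    by eventually_elim (use interior_subset in blast)
  then obtain t :: real where "0 < t" "k - t *\<^sub>R v \<in> K"
    using eventually_happens[of _ "at_right (0::real)"] by auto
  then have "t * d v \<le> d k"
    using d(1) by (fastforce simp: dual_cone_def blinfun.diff_right blinfun.scaleR_right)
  then show ?thesis using v \<open>0 < t\<close> by (smt (verit) mult_pos_pos)
qed

theorem lemma5p4:
  fixes K :: "'a::real_normed_vector set"
    and G H :: "'a dual set"
    and \<Psi> :: "'a \<Rightarrow> real"
  assumes "closed K" and "convex K" and "cone K" and "pointed K"
    and "G \<noteq> {}" and "convex G" and "compactin weak_star_topology G"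
    and "H \<noteq> {}" and "convex H" and "compactin weak_star_topology H"
    and "\<Psi> = (\<lambda>y. support_fun G y - support_fun H y)"
  shows "(cone_monotone K \<Psi> \<longleftrightarrow>
            (\<forall>y. set_le_s (dual_cone K) (support_face H y) (support_face G y)))
       \<and> (interior K \<noteq> {} \<and>
            (\<forall>y. set_le_u (dual_cone K - {0}) (support_face H y) (support_face G y))
            \<longrightarrow> strictly_cone_monotone K \<Psi>)
       \<and> (strict_dual_cone K \<noteq> {} \<and>
            (\<forall>y. set_le_u (strict_dual_cone K) (support_face H y) (support_face G y))
            \<longrightarrow> strongly_cone_monotone K \<Psi>)"
proof -
  note G = \<open>compactin weak_star_topology G\<close> \<open>G \<noteq> {}\<close>
  note H = \<open>compactin weak_star_topology H\<close> \<open>H \<noteq> {}\<close>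
  note \<Psi> = \<open>\<Psi> = _\<close>
  have "0 \<in> K" using \<open>pointed K\<close> by (auto simp: pointed_def)
  have dominates: "\<exists>g\<in>support_face G x. \<exists>d\<in>D. h = g - d"
    if "\<forall>y. set_le_u D (support_face H y) (support_face G y)" "h \<in> support_face H x" for D h x
    using that unfolding set_le_u_def by blast
  \<comment> \<open>Shared by (ii) and (iii): positivity of \<open>D\<close> on \<open>z - y\<close>
    turns the set relation into strict domination in that direction.\<close>
  have strict: "\<Psi> y < \<Psi> z"
    if le: "\<forall>y. set_le_u D (support_face H y) (support_face G y)"
      and pos: "\<And>d. d \<in> D \<Longrightarrow> 0 < blinfun_apply d (z - y)" for D y z
  proof -
    have "support_fun G y - support_fun H y
        < support_fun G (y + (z - y)) - support_fun H (y + (z - y))"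
    proof (rule support_fun_diff_strict_mono[OF G(1) H])
      fix x h
      assume "h \<in> support_face H x"
      from dominates[OF le this]
      show "\<exists>g\<in>support_face G x. blinfun_apply h (z - y) < g (z - y)"
        using pos by (force simp: blinfun.diff_left)
    qed
    then show ?thesis by (simp add: \<Psi>)
  qed
  have "set_le_s (dual_cone K) (support_face H y) (support_face G y)"
    if mono: "cone_monotone K \<Psi>" for y
  proof -
    have "\<exists>g\<in>support_face G y. \<forall>k\<in>K. blinfun_apply h k \<le> g k" if "h \<in> support_face H y" for h
    proof (rule support_face_dominated[OF G \<open>convex G\<close> H \<open>convex K\<close> \<open>cone K\<close> \<open>0 \<in> K\<close> _ that])
      fix x k
      assume "k \<in> K"
      then show "support_fun G x - support_fun H x \<le> support_fun G (x + k) - support_fun H (x + k)"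
        using mono unfolding cone_monotone_def \<Psi> by (metis add_diff_cancel_left')
    qed
    then have "set_le_u (dual_cone K) (support_face H y) (support_face G y)"
      unfolding set_le_u_def
    proof safe
      fix h
      assume "h \<in> support_face H y"
      then obtain g where "g \<in> support_face G y" "\<forall>k\<in>K. blinfun_apply h k \<le> g k"
        using \<open>\<And>h. h \<in> support_face H y \<Longrightarrow> _\<close> by blast
      then show "\<exists>b d. h = b - d \<and> b \<in> support_face G y \<and> d \<in> dual_cone K"
        by (intro exI[of _ g] exI[of _ "g - h"]) (auto simp: dual_cone_def blinfun.diff_left)
    qed
    \<comment> \<open>Exchanging \<open>G\<close> and \<open>H\<close> negates \<Psi>, which is then
      monotone along \<open>-K\<close>; domination of \<open>g\<close> by \<open>h\<close> there
      says that \<open>g - h\<close> is in the dual cone of \<open>K\<close>.\<close>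
    moreover have "\<exists>h\<in>support_face H y. \<forall>k\<in>uminus ` K. blinfun_apply g k \<le> h k"
      if "g \<in> support_face G y" for g
    proof (rule support_face_dominated[OF H \<open>convex H\<close> G _ _ _ _ that])
      show "convex (uminus ` K)" using \<open>convex K\<close> by (rule convex_negations)
      show "cone (uminus ` K)" using \<open>cone K\<close> by (auto simp: cone_def)
      show "0 \<in> uminus ` K" using \<open>0 \<in> K\<close> by force
      fix x k
      assume "k \<in> uminus ` K"
      then have "x - (x + k) \<in> K" by auto
      then have "\<Psi> (x + k) \<le> \<Psi> x" using mono unfolding cone_monotone_def by blast
      then show "support_fun H x - support_fun G x \<le> support_fun H (x + k) - support_fun G (x + k)"
        by (simp add: \<Psi>)
    qed
    then have "set_le_l (dual_cone K) (support_face H y) (support_face G y)"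
      unfolding set_le_l_def
    proof safe
      fix g
      assume "g \<in> support_face G y"
      then obtain h where "h \<in> support_face H y" "\<forall>k\<in>uminus ` K. blinfun_apply g k \<le> h k"
        using \<open>\<And>g. g \<in> support_face G y \<Longrightarrow> _\<close> by blast
      then show "\<exists>a d. g = a + d \<and> a \<in> support_face H y \<and> d \<in> dual_cone K"
        by (intro exI[of _ h] exI[of _ "g - h"])
           (auto simp: dual_cone_def blinfun.diff_left blinfun.minus_right)
    qed
    ultimately show ?thesis by (simp add: set_le_s_def)
  qed
  moreover have "cone_monotone K \<Psi>"
    if "\<forall>y. set_le_s (dual_cone K) (support_face H y) (support_face G y)"
    unfolding cone_monotone_def
  proof (intro allI impI)
    fix y z
    assume K: "z - y \<in> K"
    have le: "\<forall>y. set_le_u (dual_cone K) (support_face H y) (support_face G y)"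
      using that by (simp add: set_le_s_def)
    have "support_fun G y - support_fun H y
        \<le> support_fun G (y + (z - y)) - support_fun H (y + (z - y))"
    proof (rule support_fun_diff_mono[OF G(1) H])
      fix x h
      assume "h \<in> support_face H x"
      from dominates[OF le this]
      show "\<exists>g\<in>support_face G x. blinfun_apply h (z - y) \<le> g (z - y)"
        using K by (force simp: blinfun.diff_left dual_cone_def)
    qed
    then show "\<Psi> y \<le> \<Psi> z" by (simp add: \<Psi>)
  qed
  moreover have "strictly_cone_monotone K \<Psi>"
    if "\<forall>y. set_le_u (dual_cone K - {0}) (support_face H y) (support_face G y)"
    unfolding strictly_cone_monotone_def
    using strict[OF that] dual_cone_pos_on_interior by blast
  moreover have "strongly_cone_monotone K \<Psi>"
    if "\<forall>y. set_le_u (strict_dual_cone K) (support_face H y) (support_face G y)"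
    unfolding strongly_cone_monotone_def
    using strict[OF that] by (auto simp: strict_dual_cone_def)
  ultimately show ?thesis by blast
qed

end
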